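(* Let $\rho_0\in(L^1\cap BV)(\mathbb{R};[0,1])$ and let the following CFL condition hold: $$\Delta t\le\min\left\{\frac{\Delta x}{\gamma_0\|v'\|_{L^\infty([0,1])}+\|v\|_{L^\infty([0,1])}},\ \frac{L}{\|q_{\mathrm{on}}\|_{L^\infty([0,T])}+\|q_{\mathrm{off}}\|_{L^\infty([0,T])}}\right\}.$$ Then the approximate solution constructed by the scheme in the context satisfies, for all $j\in\mathbb{Z}$, $n=0,\dots,N_T-1$ and $\kappa\in[0,1]$, $$|\rho_j^{n+1}-\kappa|-|\rho_j^n-\kappa|+\lambda\big(\mathscr{F}^\kappa_{j+1/2}(\rho_j^n)-\mathscr{F}^\kappa_{j-1/2}(\rho_{j-1}^n)\big)-\Delta t\,\operatorname{sgn}(\rho_j^{n+1}-\kappa)\big(S_{\mathrm{on},j}^{n+1/2}-S_{\mathrm{off},j}^{n+1/2}\big)+\lambda\operatorname{sgn}(\rho_j^{n+1}-\kappa)\,\kappa\,\big(v(R_{j+1/2}^n)-v(R_{j-1/2}^n)\big)\le0,$$ where $G_{j+1/2}(u)=u\,v(R_{j+1/2}^n)$ and $\mathscr{F}^\kappa_{j+1/2}(u)=G_{j+1/2}(\max\{u,\kappa\})-G_{j+1/2}(\min\{u,\kappa\})$.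
   Context: Assumptions. $T>0$; $q_{\mathrm{on}},q_{\mathrm{off}}\in L^\infty(\mathbb{R}^+;\mathbb{R}^+)$; $v\in C^2(\mathbb{R};[0,1])$, $v'\le 0$; $\eta\in(0,1]$, $\delta\in[-\eta,\eta]$; $\omega_\eta\in C^1([0,\eta];\mathbb{R}^+)$, $\omega_\eta'\le 0$, $\int_0^\eta\omega_\eta=1$; $\omega_{\eta,\delta}\in C^1([\delta-\eta,\delta+\eta];\mathbb{R}^+)$, $\omega_{\eta,\delta}'\ge0$ on $[\delta-\eta,0]$, $\omega_{\eta,\delta}'\le0$ on $[0,\delta+\eta]$, $\int_{\delta-\eta}^{\delta+\eta}\omega_{\eta,\delta}=1$ ($\omega_{\eta,\delta}$ is extended by $0$ outside its interval). $\operatorname{sgn}(0)=0$. Mesh. $\Delta x>0$ with $\eta=N\Delta x$, $N\in\mathbb{N}$; $\Delta t>0$, $\lambda=\Delta t/\Delta x$; $x_{j-1/2}=j\Delta x$, $x_j=(j+\tfrac12)\Delta x$ for $j\in\mathbb{Z}$; $t^n=n\Delta t$; $N_T\in\mathbb{N}$ with $N_T\Delta t\le T<(N_T+1)\Delta t$. The ramps are $\Omega_{\mathrm{on}}=[\underline{x}_{\mathrm{on}},\overline{x}_{\mathrm{on}}]=[x_{\underline{k}_{\mathrm{on}}+1/2},x_{\underline{k}_{\mathrm{on}}+1/2+\ell}]$, $\Omega_{\mathrm{off}}=[\underline{x}_{\mathrm{off}},\overline{x}_{\mathrm{off}}]=[x_{\underline{k}_{\mathrm{off}}+1/2},x_{\underline{k}_{\mathrm{off}}+1/2+\ell}]$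 with $\underline{k}_{\mathrm{on}},\underline{k}_{\mathrm{off}}\in\mathbb{Z}$, $\ell\in\mathbb{Z}^+$, length $L=\ell\Delta x$. $\mathbf{1}_{\mathrm{on},j}=1/L$ if $x_j\in\Omega_{\mathrm{on}}$ and $0$ otherwise; $\mathbf{1}_{\mathrm{off},j}=1/L$ if $x_j\in\Omega_{\mathrm{off}}$ and $0$ otherwise. Discrete data. $\rho_j^0=\frac1{\Delta x}\int_{x_{j-1/2}}^{x_{j+1/2}}\rho_0\,dx$; $q_{\mathrm{on}}^{n+1/2}=\frac1{\Delta t}\int_{t^n}^{t^{n+1}}q_{\mathrm{on}}\,dt$, $q_{\mathrm{off}}^{n+1/2}=\frac1{\Delta t}\int_{t^n}^{t^{n+1}}q_{\mathrm{off}}\,dt$; $\gamma_p=\int_{p\Delta x}^{(p+1)\Delta x}\omega_\eta(y)\,dy$ for $0\le p\le N-1$; $\hat\gamma_h=\int_{h\Delta x}^{(h+1)\Delta x}\omega_{\eta,\delta}(y)\,dy$. Scheme, for $n=0,\dots,N_T-1$, $j\in\mathbb{Z}$: $R_{j+1/2}^n=\sum_{p=0}^{N-1}\gamma_p\rho_{j+p+1}^n$, $\rho_j^{n+1/2}=\rho_j^n-\lambda\big(\rho_j^nv(R_{j+1/2}^n)-\rho_{j-1}^nv(R_{j-1/2}^n)\big)$, $R_{\mathrm{on},j}^{n+1/2}=\sum_{h=\lfloor(\delta-\eta)/\Delta x\rfloor}^{\lfloor(\delta+\eta)/\Delta x\rfloor-1}\hat\gamma_h\rho_{j+h}^{n+1/2}$,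 $\rho_j^{n+1}=\rho_j^{n+1/2}+\Delta t\,S_{\mathrm{on},j}^{n+1/2}-\Delta t\,S_{\mathrm{off},j}^{n+1/2}$, with $S_{\mathrm{off},j}^{n+1/2}=\mathbf{1}_{\mathrm{off},j}q_{\mathrm{off}}^{n+1/2}\rho_j^{n+1/2}$, and $S_{\mathrm{on},j}^{n+1/2}$ given (for all $n,j$) by one of: Model 1, $S_{\mathrm{on},j}^{n+1/2}=\mathbf{1}_{\mathrm{on},j}q_{\mathrm{on}}^{n+1/2}(1-\rho_j^{n+1/2})(1-R_{\mathrm{on},j}^{n+1/2})$; Model 2, $S_{\mathrm{on},j}^{n+1/2}=\mathbf{1}_{\mathrm{on},j}q_{\mathrm{on}}^{n+1/2}\big(1-\max\{\rho_j^{n+1/2},R_{\mathrm{on},j}^{n+1/2}\}\big)$. *)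

theory Defs
  imports "HOL-Analysis.Analysis" "HOL-Probability.Essential_Supremum"
begin

(* Derivatives are taken within S, hence are one-sided at the end points of an interval. *)
primrec Ck_on :: "nat \<Rightarrow> real set \<Rightarrow> (real \<Rightarrow> real) \<Rightarrow> bool" where
  "Ck_on 0 S f \<longleftrightarrow> continuous_on S f"
| "Ck_on (Suc k) S f \<longleftrightarrow>
     (\<exists>f'. (\<forall>x\<in>S. (f has_real_derivative f' x) (at x within S)) \<and> Ck_on k S f')"

definition Linf_norm :: "real set \<Rightarrow> (real \<Rightarrow> real) \<Rightarrow> ereal" where
  "Linf_norm S f = esssup (lebesgue_on S) (\<lambda>x. ereal \<bar>f x\<bar>)"

(* f represents a class in L^infinity(S;B); its values outside S play no role. *)
definition Linf :: "real set \<Rightarrow> real set \<Rightarrow> (real \<Rightarrow> real) \<Rightarrow> bool" where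
  "Linf S B f \<longleftrightarrow>
     f \<in> borel_measurable (lebesgue_on S) \<and> (AE x in lebesgue_on S. f x \<in> B) \<and> Linf_norm S f < \<infinity>"

(* Distributional total variation on the line, which does not depend on the a.e. representative. *)
definition total_variation :: "(real \<Rightarrow> real) \<Rightarrow> ereal" where
  "total_variation f =
     (SUP \<phi> \<in> {\<phi>. Ck_on 1 UNIV \<phi> \<and> compact (closure {x. \<phi> x \<noteq> 0}) \<and> (\<forall>x. \<bar>\<phi> x\<bar> \<le> 1)}.
        ereal (LINT x|lebesgue. f x * deriv \<phi> x))"

definition L1_BV :: "real set \<Rightarrow> (real \<Rightarrow> real) \<Rightarrow> bool" where
  "L1_BV B f \<longleftrightarrow>
     integrable lebesgue f \<and> (AE x in lebesgue. f x \<in> B) \<and> total_variation f < \<infinity>"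

definition extend_zero :: "real set \<Rightarrow> (real \<Rightarrow> real) \<Rightarrow> real \<Rightarrow> real" where
  "extend_zero S f x = (if x \<in> S then f x else 0)"

(* Mesh points: x_j = (j + 1/2) dx is the centre of cell j and x_{j+1/2} = (j + 1) dx its right
   interface.  Quantities carrying the index j + 1/2 are indexed by the integer j throughout,
   so that the interface x_{j-1/2} = j dx is "interface dx (j - 1)". *)
definition centre :: "real \<Rightarrow> int \<Rightarrow> real" where
  "centre dx j = (real_of_int j + 1 / 2) * dx"

definition interface :: "real \<Rightarrow> int \<Rightarrow> real" where
  "interface dx j = (real_of_int j + 1) * dx"

definition ramp_ind :: "real \<Rightarrow> real \<Rightarrow> real set \<Rightarrow> int \<Rightarrow> real" where
  "ramp_ind dx L \<Omega> j = (if centre dx j \<in> \<Omega> then 1 / L else 0)"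

(* G_{j+1/2}(u) and the Kruzkov-type flux F^kappa_{j+1/2}(u) at time level n, where R n j stands
   for R_{j+1/2}^n. *)
definition G_flux :: "(real \<Rightarrow> real) \<Rightarrow> (nat \<Rightarrow> int \<Rightarrow> real) \<Rightarrow> nat \<Rightarrow> int \<Rightarrow> real \<Rightarrow> real" where
  "G_flux v R n j u = u * v (R n j)"

definition K_flux ::
  "(real \<Rightarrow> real) \<Rightarrow> (nat \<Rightarrow> int \<Rightarrow> real) \<Rightarrow> real \<Rightarrow> nat \<Rightarrow> int \<Rightarrow> real \<Rightarrow> real" where
  "K_flux v R \<kappa> n j u = G_flux v R n j (max u \<kappa>) - G_flux v R n j (min u \<kappa>)"

end

theory Submission
  imports Defs
begin

text \<open>
Write \<open>V = v (R n j)\<close> and \<open>W = v (R n (j - 1))\<close>. With these two speeds frozen, the convective half step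
is the affine map sending \<open>(a, b)\<close> to \<open>(1 - lam * V) * a + lam * W * b\<close>, taken at
\<open>a = \<rho> n j\<close> and \<open>b = \<rho> n (j - 1)\<close>, and the Kruzkov fluxes are \<open>\<bar>a - \<kappa>\<bar> * V\<close> and \<open>\<bar>b - \<kappa>\<bar> * W\<close>. If
\<open>lam * V \<le> 1\<close> both coefficients are nonnegative, so comparing the values at \<open>(a, b)\<close> and \<open>(\<kappa>, \<kappa>)\<close> by the
triangle inequality gives
\<open>\<bar>\<rho>h n j - (\<kappa> - lam * \<kappa> * (V - W))\<bar> \<le> \<bar>a - \<kappa>\<bar> - lam * (\<bar>a - \<kappa>\<bar> * V - \<bar>b - \<kappa>\<bar> * W)\<close>
(\<open>upwind_entropy_inequality\<close>). Multiplying the quantity between the bars by the sign of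
\<open>\<rho> (Suc n) j - \<kappa>\<close> can only lower its absolute value; substituting
\<open>\<rho>h n j = \<rho> (Suc n) j - dt * (S_on n j - S_off n j)\<close> then yields the entropy inequality, with the sign
evaluated at the new density.

The analytic content is therefore the bound \<open>lam * V \<le> 1\<close>. The CFL condition controls \<open>v\<close> on \<open>{0..1}\<close>
only, so the averages \<open>R n j\<close> have to lie there, and this requires the maximum principle
\<open>\<rho> n j \<in> {0..1}\<close>, proved by induction on \<open>n\<close>. The delicate point is the upper bound in the convective
half step, where the gain \<open>\<rho>h n j - \<rho> n j\<close> is at most \<open>lam * ((W - V) + (1 - \<rho> n j) * V)\<close>. As the speed
decreases in the downstream average, \<open>W - V\<close> is controlled by the increment \<open>R n j - R n (j - 1)\<close>; as the
weights \<open>\<gamma>\<close> are nonnegative and nonincreasing, summation by parts bounds this increment by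
\<open>\<gamma> 0 * (1 - \<rho> n j)\<close> (\<open>downstream_average_increment\<close>). So the whole gain is proportional to the remaining
room \<open>1 - \<rho> n j\<close>, and the first CFL bound makes the factor at most one (\<open>upwind_step_in_unit_interval\<close>).
In the source step, the second CFL bound says that the entering and leaving rates times the time step add
up to at most one, so that neither ramp can overshoot (\<open>source_step_in_unit_interval\<close>).
\<close>

section \<open>Essential bounds and integrals over intervals\<close>


lemma set_integral_Icc_bounds:
  fixes f :: "real \<Rightarrow> real"
  assumes "a \<le> b" and f: "f \<in> borel_measurable (lebesgue_on {a..b})"
    and bd: "AE x in lebesgue. x \<in> {a..b} \<longrightarrow> f x \<in> {l..u}"
  shows "(LINT x:{a..b}|lebesgue. f x) \<in> {(b - a) * l..(b - a) * u}"
proof -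
  let ?M = "lebesgue_on {a..b}"
  have fin: "finite_measure ?M"
    by (rule finite_measure_lebesgue_on) auto
  have bd': "AE x in ?M. f x \<in> {l..u}"
    using bd by (subst AE_restrict_space_iff) auto
  have int: "integrable ?M f"
    by (rule finite_measure.integrable_const_bound[OF fin _ f, where B = "max \<bar>l\<bar> \<bar>u\<bar>"])
       (use bd' in eventually_elim, auto)
  have c: "(LINT x|?M. c) = (b - a) * c" for c :: real
    using \<open>a \<le> b\<close> by (simp add: measure_restrict_space)
  have ci: "integrable ?M (\<lambda>x. c)" for c :: real
    using fin by (simp add: finite_measure.integrable_const)
  have "(LINT x|?M. l) \<le> (LINT x|?M. f x)" "(LINT x|?M. f x) \<le> (LINT x|?M. u)"
    by (rule integral_mono_AE; use int ci bd' in auto)+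
  moreover have "(LINT x|?M. f x) = (LINT x:{a..b}|lebesgue. f x)"
    by (simp add: integral_restrict_space set_lebesgue_integral_def)
  ultimately show ?thesis
    unfolding c by simp
qed

lemma AE_abs_le_Linf_norm:
  assumes "S \<in> sets lebesgue"
  shows "AE x in lebesgue. x \<in> S \<longrightarrow> ereal \<bar>f x\<bar> \<le> Linf_norm S f"
  using esssup_AE[of "\<lambda>x. ereal \<bar>f x\<bar>" "lebesgue_on S"] assms
  by (simp add: Linf_norm_def AE_restrict_space_iff)

text \<open>For a continuous function an essential bound is a pointwise one: the points that respect it form a
closed set of full measure, and such a set contains the whole interval. This is what allows the
\<open>L\<^sup>\<infinity>\<close> norms in the CFL condition to be used at the individual values \<open>R n j\<close>.\<close>

lemma Linf_norm_continuous_interval: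
  fixes g :: "real \<Rightarrow> real"
  assumes "a < b" and g: "continuous_on {a..b} g"
  obtains m where "Linf_norm {a..b} g = ereal m" and "\<And>x. x \<in> {a..b} \<Longrightarrow> \<bar>g x\<bar> \<le> m"
proof -
  define n where "n = Linf_norm {a..b} g"
  let ?C = "{a..b} \<inter> (\<lambda>x. ereal \<bar>g x\<bar>) -` {..n}"
  have "closed ?C"
    using g by (intro continuous_closed_preimage continuous_on_ereal continuous_on_rabs) auto
  moreover have "x \<in> ?C" if "x \<in> {a<..<b}" for x
  proof (rule mem_closed_if_AE_lebesgue_open[OF open_greaterThanLessThan \<open>closed ?C\<close> _ that])
    show "AE x\<in>{a<..<b} in lebesgue. x \<in> ?C"
      using AE_abs_le_Linf_norm[of "{a..b}" g] by (rule eventually_mono) (use n_def in auto)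
  qed
  ultimately have "closure {a<..<b} \<subseteq> ?C"
    by (intro closure_minimal) auto
  with \<open>a < b\<close> have le: "ereal \<bar>g x\<bar> \<le> n" if "x \<in> {a..b}" for x
    using that by auto
  have "bounded (g ` {a..b})"
    using g by (simp add: compact_continuous_image compact_imp_bounded)
  then obtain B where B: "\<And>x. x \<in> {a..b} \<Longrightarrow> \<bar>g x\<bar> \<le> B"
    unfolding bounded_iff by fastforce
  have meas: "g \<in> borel_measurable (lebesgue_on {a..b})"
    by (rule continuous_imp_measurable_on_sets_lebesgue[OF g]) auto
  have "n \<le> ereal B"
    unfolding n_def Linf_norm_def
  proof (rule esssup_I)
    show "(\<lambda>x. ereal \<bar>g x\<bar>) \<in> borel_measurable (lebesgue_on {a..b})"
      using meas by measurable
    show "AE x in lebesgue_on {a..b}. ereal \<bar>g x\<bar> \<le> ereal B"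
      by (rule AE_I2) (use B in simp)
  qed
  moreover have "ereal \<bar>g a\<bar> \<le> n"
    using le \<open>a < b\<close> by auto
  ultimately obtain m where "n = ereal m"
    by (cases n) auto
  with le that show ?thesis
    by (auto simp: n_def)
qed

text \<open>The CFL condition takes the norm over \<open>{0..T}\<close>, while the data are essentially bounded on the half
line. Finiteness is inherited from there; the norm is not the essential supremum \<open>-\<infinity>\<close> of a null set
because \<open>0 < T\<close>.\<close>

lemma Linf_nonneg_integral_bounds:
  assumes q: "Linf {0..} {0..} q" and "0 < T"
  obtains Q where "Linf_norm {0..T} q = ereal Q" and "0 \<le> Q"
    and "\<And>s t. 0 \<le> s \<Longrightarrow> s < t \<Longrightarrow> t \<le> T \<Longrightarrow>
           (LINT x:{s..t}|lebesgue. q x) \<in> {0..(t - s) * Q}"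
proof -
  let ?Q = "Linf_norm {0..T} q"
  have bd: "AE x in lebesgue. x \<in> {0..} \<longrightarrow> q x \<in> {0..}"
  proof -
    have "AE x in lebesgue_on {0..}. q x \<in> {0..}"
      using q unfolding Linf_def by blast
    then show ?thesis
      by (subst (asm) AE_restrict_space_iff) auto
  qed
  have meas: "q \<in> borel_measurable (lebesgue_on {s..t})" if "0 \<le> s" for s t
  proof (rule measurable_restrict_mono)
    show "q \<in> borel_measurable (lebesgue_on {0..})"
      using q unfolding Linf_def by blast
  qed (use that in auto)
  have AE_Q: "AE x in lebesgue. x \<in> {0..T} \<longrightarrow> ereal \<bar>q x\<bar> \<le> ?Q"
    by (rule AE_abs_le_Linf_norm) auto
  have "?Q \<le> Linf_norm {0..} q"
    unfolding Linf_norm_def[of "{0..T}"]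
  proof (rule esssup_I)
    show "AE x in lebesgue_on {0..T}. ereal \<bar>q x\<bar> \<le> Linf_norm {0..} q"
    proof (subst AE_restrict_space_iff)
      show "AE x in lebesgue. x \<in> {0..T} \<longrightarrow> ereal \<bar>q x\<bar> \<le> Linf_norm {0..} q"
        using AE_abs_le_Linf_norm[of "{0..}" q] by (rule eventually_mono) auto
    qed auto
    show "(\<lambda>x. ereal \<bar>q x\<bar>) \<in> borel_measurable (lebesgue_on {0..T})"
      using meas[of 0 T] by measurable
  qed
  also have "\<dots> < \<infinity>"
    using q unfolding Linf_def by blast
  finally have "?Q \<noteq> \<infinity>"
    by simp
  moreover have "?Q \<noteq> -\<infinity>"
  proof
    assume "?Q = -\<infinity>"
    have "AE x\<in>{0<..<T} in lebesgue. x \<in> {}"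
      using AE_Q by (rule eventually_mono) (use \<open>?Q = -\<infinity>\<close> in auto)
    from mem_closed_if_AE_lebesgue_open[OF open_greaterThanLessThan closed_empty this, of "T / 2"]
    show False
      using \<open>0 < T\<close> by simp
  qed
  ultimately obtain Q where Q: "?Q = ereal Q"
    by (cases ?Q) auto
  have bounds: "(LINT x:{s..t}|lebesgue. q x) \<in> {0..(t - s) * Q}"
    if "0 \<le> s" "s < t" "t \<le> T" for s t
  proof -
    have "AE x in lebesgue. x \<in> {s..t} \<longrightarrow> q x \<in> {0..Q}"
      using bd AE_Q by eventually_elim (use that Q in auto)
    from set_integral_Icc_bounds[OF _ meas this] show ?thesis
      using that by simp
  qed
  have "0 \<le> T * Q"
    using bounds[of 0 T] \<open>0 < T\<close> by simp
  then have "0 \<le> Q"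
    using \<open>0 < T\<close> by (simp add: zero_le_mult_iff)
  with Q bounds that show ?thesis
    by blast
qed

text \<open>In \<open>ereal\<close> a positive number divided by zero is \<open>\<infinity>\<close>, so the CFL bounds become products without a
case distinction on a vanishing denominator.\<close>

lemma ereal_le_divide_imp_mult_le:
  assumes "ereal a \<le> ereal b / ereal c" and "0 \<le> b" and "0 \<le> c"
  shows "a * c \<le> b"
proof (cases "c = 0")
  case False
  with assms show ?thesis
    by (simp add: pos_le_divide_eq)
qed (use assms in auto)

section \<open>Differentiability classes\<close>

lemma Ck_on_1_imp_continuous_on:
  assumes "Ck_on 1 S f"
  shows "continuous_on S f"
  using assms unfolding One_nat_def Ck_on.simps by (auto intro: DERIV_continuous_on)

lemma Ck_on_2_UNIV_deriv:
  assumes "Ck_on 2 UNIV f"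
  shows "(f has_real_derivative deriv f x) (at x)" and "continuous_on UNIV f"
    and "continuous_on UNIV (deriv f)"
proof -
  from assms obtain f' where f': "\<forall>x\<in>UNIV. (f has_real_derivative f' x) (at x within UNIV)"
    and "Ck_on 1 UNIV f'"
    unfolding numeral_2_eq_2 One_nat_def Ck_on.simps(2)[of "Suc 0"] by blast
  have eq: "deriv f = f'"
    using f' by (intro ext DERIV_imp_deriv) simp
  then show "(f has_real_derivative deriv f x) (at x)"
    using f' by simp
  show "continuous_on UNIV f"
    using f' by (intro DERIV_continuous_on[of UNIV f f']) simp
  show "continuous_on UNIV (deriv f)"
    unfolding eq by (rule Ck_on_1_imp_continuous_on) fact
qed

lemma Ck_on_1_nonpos_imp_antimono_on:
  assumes "Ck_on 1 {a..b} f"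
    and nonpos: "\<And>x. x \<in> {a..b} \<Longrightarrow> vector_derivative f (at x within {a..b}) \<le> 0"
  shows "antimono_on {a..b} f"
proof (rule monotone_onI)
  fix x y assume xy: "x \<in> {a..b}" "y \<in> {a..b}" "x \<le> y"
  from assms(1) obtain f' where
    f': "\<And>x. x \<in> {a..b} \<Longrightarrow> (f has_real_derivative f' x) (at x within {a..b})"
    unfolding One_nat_def Ck_on.simps by metis
  show "f y \<le> f x"
  proof (cases "a < b")
    case True
    have np: "f' z \<le> 0" if "z \<in> {a..b}" for z
      using vector_derivative_within_closed_interval[OF True that, of f "f' z"] f'[OF that]
        nonpos[OF that] by (simp add: has_real_derivative_iff_has_vector_derivative)
    have "\<exists>z\<in>{x..y}. f y - f x = f' z * (y - x)"
      using xy(3)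
    proof (rule mvt_very_simple)
      fix z assume "x \<le> z" "z \<le> y"
      then have "(f has_real_derivative f' z) (at z within {x..y})"
        using xy by (intro DERIV_subset[OF f']) auto
      then show "(f has_derivative (\<lambda>h. f' z * h)) (at z within {x..y})"
        by (simp add: has_field_derivative_def)
    qed
    then obtain z where "z \<in> {x..y}" "f y - f x = f' z * (y - x)"
      by auto
    then show ?thesis
      using np[of z] xy mult_nonpos_nonneg[of "f' z" "y - x"] by auto
  next
    case False
    with xy have "x = y"
      by auto
    then show ?thesis
      by simp
  qed
qed

section \<open>Weights of the discrete averages\<close>

text \<open>Neighbouring closed cells share only an end point, so up to null sets the cells are disjoint and the
sum is the integral over a part of the line.\<close>

lemma sum_cell_integrals_le:
  fixes f :: "real \<Rightarrow> real" and I :: "int set"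
  assumes f: "integrable lebesgue f" and nonneg: "\<And>x. 0 \<le> f x" and "0 < d" and "finite I"
  shows "(\<Sum>i\<in>I. LINT x:{of_int i * d..of_int (i + 1) * d}|lebesgue. f x) \<le> (LINT x|lebesgue. f x)"
proof -
  let ?A = "\<lambda>i::int. {of_int i * d<..<of_int (i + 1) * d}"
  have si: "set_integrable lebesgue A f" if "A \<in> sets lebesgue" for A
    unfolding set_integrable_def using integrable_mult_indicator[OF that f] .
  have disj: "disjoint_family_on ?A I"
    unfolding disjoint_family_on_def disjoint_iff
  proof (intro ballI impI allI notI)
    fix i k :: int and x
    assume "i \<noteq> k" and "x \<in> ?A i" and "x \<in> ?A k"
    then have "of_int i * d < of_int (k + 1) * d" "of_int k * d < of_int (i + 1) * d"
      by (simp_all only: greaterThanLessThan_iff) linarith+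
    then have "i < k + 1" "k < i + 1"
      using \<open>0 < d\<close> by (simp_all only: mult_less_cancel_right_pos of_int_less_iff)
    with \<open>i \<noteq> k\<close> show False
      by linarith
  qed
  have "(\<Sum>i\<in>I. LINT x:{of_int i * d..of_int (i + 1) * d}|lebesgue. f x)
      = (\<Sum>i\<in>I. LINT x:?A i|lebesgue. f x)"
  proof (rule sum.cong[OF refl], rule set_integral_null_delta[OF f])
    fix i
    have "({of_int i * d..of_int (i + 1) * d} - ?A i) \<union> (?A i - {of_int i * d..of_int (i + 1) * d})
        \<subseteq> {of_int i * d, of_int (i + 1) * d}"
      by auto
    then show "({of_int i * d..of_int (i + 1) * d} - ?A i) \<union> (?A i - {of_int i * d..of_int (i + 1) * d})
        \<in> null_sets lebesgue"
      by (meson finite.intros finite_imp_null_set_lborel finite_subset null_sets_completionI)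
  qed auto
  also have "\<dots> = (LINT x:(\<Union>i\<in>I. ?A i)|lebesgue. f x)"
    by (rule set_integral_finite_Union[symmetric, OF \<open>finite I\<close> disj si]) auto
  also have "\<dots> \<le> (LINT x|lebesgue. f x)"
    unfolding set_lebesgue_integral_def
    by (rule integral_mono'[OF f]) (simp_all add: indicator_def nonneg)
  finally show ?thesis .
qed

lemma extended_kernel_integral:
  fixes k :: "real \<Rightarrow> real"
  assumes "continuous_on {a..b} k" and "(LINT y:{a..b}|lebesgue. k y) = 1"
  shows "integrable lebesgue (extend_zero {a..b} k)" and "(LINT y|lebesgue. extend_zero {a..b} k y) = 1"
proof -
  have eq: "extend_zero {a..b} k = (\<lambda>y. indicator {a..b} y *\<^sub>R k y)"
    by (auto simp: extend_zero_def)
  show "integrable lebesgue (extend_zero {a..b} k)"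
    using absolutely_integrable_continuous_real[OF assms(1)] by (simp only: eq set_integrable_def)
  show "(LINT y|lebesgue. extend_zero {a..b} k y) = 1"
    using assms(2) by (simp only: eq set_lebesgue_integral_def)
qed

lemma nonneg_kernel_cell_weights:
  fixes k :: "real \<Rightarrow> real" and a b d :: real and I :: "int set"
  defines "w \<equiv> \<lambda>i::int. LINT y:{of_int i * d..of_int (i + 1) * d}|lebesgue. extend_zero {a..b} k y"
  assumes "continuous_on {a..b} k" and "\<forall>x\<in>{a..b}. 0 \<le> k x"
    and "(LINT y:{a..b}|lebesgue. k y) = 1" and "0 < d" and "finite I"
  shows "0 \<le> w i" and "sum w I \<le> 1"
proof -
  have nonneg: "0 \<le> extend_zero {a..b} k x" for x
    using assms(3) by (simp add: extend_zero_def)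
  show "0 \<le> w i"
    unfolding w_def set_lebesgue_integral_def by (rule Bochner_Integration.integral_nonneg) (simp add: nonneg)
  show "sum w I \<le> 1"
    using sum_cell_integrals_le[OF extended_kernel_integral(1)[OF assms(2,4)] nonneg \<open>0 < d\<close> \<open>finite I\<close>]
    unfolding w_def extended_kernel_integral(2)[OF assms(2,4)] .
qed

text \<open>On each cell a nonincreasing kernel lies between its values at the two ends. Hence the weight of a cell
is at least \<open>d\<close> times the kernel at the right end, and the next weight is at most that.\<close>

lemma decreasing_kernel_cell_weights:
  fixes \<omega> :: "real \<Rightarrow> real" and \<gamma> :: "nat \<Rightarrow> real"
  assumes cont: "continuous_on {0..real N * d} \<omega>" and anti: "antimono_on {0..real N * d} \<omega>"
    and nonneg: "\<forall>x\<in>{0..real N * d}. 0 \<le> \<omega> x"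
    and one: "(LINT y:{0..real N * d}|lebesgue. \<omega> y) = 1" and "0 < d"
    and \<gamma>: "\<forall>p<N. \<gamma> p = (LINT y:{real p * d..real (Suc p) * d}|lebesgue. \<omega> y)"
  shows "\<And>p. p < N \<Longrightarrow> 0 \<le> \<gamma> p" and "\<And>p. Suc p < N \<Longrightarrow> \<gamma> (Suc p) \<le> \<gamma> p"
    and "(\<Sum>p<N. \<gamma> p) \<le> 1"
proof -
  have grid: "real p * d \<in> {0..real N * d}" if "p \<le> N" for p
    using that \<open>0 < d\<close> by auto
  have bounds: "\<gamma> p \<in> {d * \<omega> (real (Suc p) * d)..d * \<omega> (real p * d)}" if "p < N" for p
  proof -
    let ?J = "{real p * d..real (Suc p) * d}"
    have sub: "?J \<subseteq> {0..real N * d}"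
      using grid[of p] grid[of "Suc p"] that by auto
    have meas: "\<omega> \<in> borel_measurable (lebesgue_on ?J)"
      by (rule continuous_imp_measurable_on_sets_lebesgue[OF continuous_on_subset[OF cont sub]]) auto
    have ae: "AE x in lebesgue. x \<in> ?J \<longrightarrow> \<omega> x \<in> {\<omega> (real (Suc p) * d)..\<omega> (real p * d)}"
    proof (rule AE_I2, rule impI)
      fix x assume "x \<in> ?J"
      with sub grid[of p] grid[of "Suc p"] that
      show "\<omega> x \<in> {\<omega> (real (Suc p) * d)..\<omega> (real p * d)}"
        by (simp only: atLeastAtMost_iff) (intro conjI monotone_onD[OF anti]; auto)
    qed
    have len: "real (Suc p) * d - real p * d = d"
      by (simp add: algebra_simps)
    then have "real p * d \<le> real (Suc p) * d"
      using \<open>0 < d\<close> by linarith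
    from set_integral_Icc_bounds[OF this meas ae] show ?thesis
      unfolding \<gamma>[rule_format, OF that] len .
  qed
  show "0 \<le> \<gamma> p" if "p < N" for p
  proof -
    have "0 \<le> d * \<omega> (real (Suc p) * d)"
      using nonneg[rule_format, OF grid[of "Suc p"]] that \<open>0 < d\<close> by simp
    with bounds[OF that] show ?thesis
      by (simp only: atLeastAtMost_iff) linarith
  qed
  show "\<gamma> (Suc p) \<le> \<gamma> p" if "Suc p < N" for p
    using bounds[of p] bounds[of "Suc p"] that by simp
  let ?w = "\<lambda>i::int. LINT y:{of_int i * d..of_int (i + 1) * d}|lebesgue. extend_zero {0..real N * d} \<omega> y"
  have "\<gamma> p = ?w (int p)" if "p < N" for p
  proof -
    have "{real p * d..real (Suc p) * d} \<subseteq> {0..real N * d}"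
      using grid[of p] grid[of "Suc p"] that by auto
    then have "\<gamma> p = (LINT y:{real p * d..real (Suc p) * d}|lebesgue. extend_zero {0..real N * d} \<omega> y)"
      unfolding \<gamma>[rule_format, OF that] by (intro set_lebesgue_integral_cong) (auto simp: extend_zero_def)
    then show ?thesis
      by (simp add: add.commute)
  qed
  then have "(\<Sum>p<N. \<gamma> p) = sum ?w (int ` {..<N})"
    by (simp add: sum.reindex)
  also have "\<dots> \<le> 1"
    by (rule nonneg_kernel_cell_weights(2)[OF cont nonneg one \<open>0 < d\<close>]) auto
  finally show "(\<Sum>p<N. \<gamma> p) \<le> 1" .
qed

section \<open>Local bounds for one time step\<close>

text \<open>The total mass may be below one: when \<open>\<delta> / dx\<close> is not an integer, the cells entering \<open>R_on\<close> leave out the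
right end of the interval that carries its kernel.\<close>

lemma weighted_sum_in_unit_interval:
  fixes w u :: "'i \<Rightarrow> real"
  assumes "\<And>i. i \<in> I \<Longrightarrow> 0 \<le> w i" and "sum w I \<le> 1" and "\<And>i. i \<in> I \<Longrightarrow> u i \<in> {0..1}"
  shows "(\<Sum>i\<in>I. w i * u i) \<in> {0..1}"
proof -
  have "(\<Sum>i\<in>I. w i * u i) \<le> sum w I"
    using assms by (intro sum_mono) (auto intro: mult_left_le)
  moreover have "0 \<le> (\<Sum>i\<in>I. w i * u i)"
    using assms by (intro sum_nonneg) auto
  ultimately show ?thesis
    using assms(2) by auto
qed

text \<open>Both sides are expressed through \<open>a - \<kappa>\<close> and \<open>b - \<kappa>\<close>: the difference between the upwind values at
\<open>(a, b)\<close> and \<open>(\<kappa>, \<kappa>)\<close> is their combination with the nonnegative coefficients \<open>1 - l * V\<close> and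
\<open>l * W\<close>, and \<open>max x \<kappa> - min x \<kappa>\<close> is \<open>\<bar>x - \<kappa>\<bar>\<close>, so only the triangle inequality is left.\<close>

lemma upwind_entropy_inequality:
  fixes a b \<kappa> V W l :: real
  assumes "l * V \<le> 1" and "0 \<le> l * W"
  shows "\<bar>(a - l * (a * V - b * W)) - (\<kappa> - l * \<kappa> * (V - W))\<bar>
       \<le> \<bar>a - \<kappa>\<bar> - l * ((max a \<kappa> * V - min a \<kappa> * V) - (max b \<kappa> * W - min b \<kappa> * W))"
proof -
  have split: "max x \<kappa> * Z - min x \<kappa> * Z = \<bar>x - \<kappa>\<bar> * Z" for x Z :: real
    by (auto simp: max_def min_def algebra_simps)
  have "(a - l * (a * V - b * W)) - (\<kappa> - l * \<kappa> * (V - W))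
      = (1 - l * V) * (a - \<kappa>) + l * W * (b - \<kappa>)"
    by (simp add: algebra_simps)
  also have "\<bar>\<dots>\<bar> \<le> \<bar>(1 - l * V) * (a - \<kappa>)\<bar> + \<bar>l * W * (b - \<kappa>)\<bar>"
    by (rule abs_triangle_ineq)
  also have "\<dots> = (1 - l * V) * \<bar>a - \<kappa>\<bar> + l * W * \<bar>b - \<kappa>\<bar>"
    using assms by (simp add: abs_mult[of "1 - l * V"] abs_mult[of "l * W"])
  also have "\<dots> = \<bar>a - \<kappa>\<bar> - l * (\<bar>a - \<kappa>\<bar> * V - \<bar>b - \<kappa>\<bar> * W)"
    by (simp add: algebra_simps)
  finally show ?thesis
    by (simp only: split)
qed

text \<open>Summation by parts. In terms of the free room \<open>1 - u\<close>, the coefficient of each interior cell is a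
difference of consecutive weights and has a favourable sign, as has the last boundary term; only the
boundary term at the cell \<open>j\<close> itself remains.\<close>

lemma downstream_average_increment:
  fixes u :: "int \<Rightarrow> real" and \<gamma> :: "nat \<Rightarrow> real"
  assumes "0 < N" and nonneg: "\<And>p. p < N \<Longrightarrow> 0 \<le> \<gamma> p"
    and decr: "\<And>p. Suc p < N \<Longrightarrow> \<gamma> (Suc p) \<le> \<gamma> p" and u: "\<And>i. u i \<le> 1"
  shows "(\<Sum>p<N. \<gamma> p * u (j + int p + 1)) - (\<Sum>p<N. \<gamma> p * u (j + int p)) \<le> \<gamma> 0 * (1 - u j)"
proof -
  \<comment> \<open>The last boundary term is kept in the induction: it absorbs the next summand since \<open>\<gamma>\<close> decreases.\<close>
  have "(\<Sum>p<Suc n. \<gamma> p * (u (j + int p + 1) - u (j + int p)))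
      \<le> \<gamma> 0 * (1 - u j) - \<gamma> n * (1 - u (j + int n + 1))" if "Suc n \<le> N" for n
    using that
  proof (induction n)
    case (Suc n)
    have "\<gamma> (Suc n) * (1 - u (j + int n + 1)) \<le> \<gamma> n * (1 - u (j + int n + 1))"
      using decr[of n] u Suc.prems by (intro mult_right_mono) (auto simp: Suc_le_eq)
    moreover have "j + int (Suc n) = j + int n + 1"
      by simp
    ultimately show ?case
      using Suc.IH Suc.prems by (simp add: algebra_simps)
  qed (simp add: algebra_simps)
  from this[of "N - 1"] \<open>0 < N\<close>
  have "(\<Sum>p<N. \<gamma> p * (u (j + int p + 1) - u (j + int p)))
      \<le> \<gamma> 0 * (1 - u j) - \<gamma> (N - 1) * (1 - u (j + int (N - 1) + 1))"
    by simp
  also have "\<dots> \<le> \<gamma> 0 * (1 - u j)"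
    using nonneg[of "N - 1"] u \<open>0 < N\<close> by simp
  finally show ?thesis
    by (simp add: sum_subtractf algebra_simps)
qed

text \<open>The one-sided bound \<open>s - r \<le> d\<close> suffices because \<open>v\<close> does not increase: for \<open>s \<le> r\<close> the left-hand side is
nonpositive.\<close>

lemma nonincreasing_drop_le:
  fixes v :: "real \<Rightarrow> real"
  assumes deriv: "\<And>x. (v has_real_derivative v' x) (at x)" and nonpos: "\<And>x. v' x \<le> 0"
    and m: "\<And>x. x \<in> {0..1} \<Longrightarrow> \<bar>v' x\<bar> \<le> m"
    and rs: "r \<in> {0..1}" "s \<in> {0..1}" and "s - r \<le> d" and "0 \<le> d"
  shows "v r - v s \<le> m * d"
proof -
  have "0 \<le> m"
    using m[of 0] by auto
  show ?thesis
  proof (cases "r < s")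
    case True
    from MVT2[OF this deriv] obtain z where z: "r < z" "z < s" "v s - v r = (s - r) * v' z"
      by auto
    have "v r - v s = (s - r) * (- v' z)"
      using z by (simp add: algebra_simps)
    also have "\<dots> \<le> d * m"
      using m[of z] z rs assms(6) \<open>0 \<le> d\<close> nonpos[of z] by (intro mult_mono) auto
    finally show ?thesis
      by (simp add: mult.commute)
  next
    case False
    then have "v r \<le> v s"
      by (intro DERIV_nonpos_imp_nonincreasing[of s r v]) (use deriv nonpos in \<open>simp, blast\<close>)
    moreover have "0 \<le> m * d"
      using \<open>0 \<le> m\<close> \<open>0 \<le> d\<close> by simp
    ultimately show ?thesis
      by linarith
  qed
qed

text \<open>The lower bound holds because the step is a combination of \<open>a\<close> and \<open>b\<close> with nonnegative coefficients. For
the upper bound the inflow is at most \<open>W\<close>, and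
\<open>W - a * V = (W - V) + (1 - a) * V \<le> (D + B) * (1 - a)\<close>: the gain is a multiple of the room \<open>1 - a\<close>, and
the condition on \<open>l\<close> makes the multiple at most one.\<close>

lemma upwind_step_in_unit_interval:
  fixes a b V W l B D :: real
  assumes ab: "a \<in> {0..1}" "b \<in> {0..1}" and "0 \<le> V" "0 \<le> W" "0 \<le> l" "0 \<le> D" and "V \<le> B"
    and drop: "W - V \<le> D * (1 - a)" and cfl: "l * (D + B) \<le> 1"
  shows "a - l * (a * V - b * W) \<in> {0..1}"
proof -
  have "l * V \<le> l * (D + B)"
    using assms by (intro mult_left_mono) auto
  then have "l * V \<le> 1"
    using cfl by linarith
  have "a - l * (a * V - b * W) = a * (1 - l * V) + l * b * W"
    by (simp add: algebra_simps)
  also have "\<dots> \<ge> 0"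
    using assms \<open>l * V \<le> 1\<close> by (intro add_nonneg_nonneg mult_nonneg_nonneg) auto
  finally have lower: "0 \<le> a - l * (a * V - b * W)" .
  have "b * W \<le> W"
    using ab \<open>0 \<le> W\<close> by (intro mult_left_le_one_le) auto
  then have "b * W - a * V \<le> (W - V) + (1 - a) * V"
    by (simp add: algebra_simps)
  also have "\<dots> \<le> D * (1 - a) + (1 - a) * B"
    using drop ab \<open>V \<le> B\<close> by (intro add_mono mult_left_mono) auto
  finally have "l * (b * W - a * V) \<le> l * ((D + B) * (1 - a))"
    using \<open>0 \<le> l\<close> by (intro mult_left_mono) (auto simp: algebra_simps)
  also have "\<dots> \<le> 1 - a"
    using mult_right_mono[OF cfl, of "1 - a"] ab by (simp add: mult.assoc)
  finally have "a - l * (a * V - b * W) \<le> 1"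
    by (simp add: algebra_simps)
  with lower show ?thesis
    by simp
qed

text \<open>Common form of both source models: \<open>A\<close> and \<open>B\<close> are the entering and leaving rates times the time step, and
\<open>X\<close> is the inflow factor, \<open>(1 - h) * (1 - r)\<close> or \<open>1 - max h r\<close>, where \<open>r\<close> is the average at the on-ramp. Either
factor lies between \<open>0\<close> and the room \<open>1 - h\<close> once \<open>h\<close> and \<open>r\<close> are in the unit interval.\<close>

lemma source_step_in_unit_interval:
  fixes h A B X :: real
  assumes "h \<in> {0..1}" "0 \<le> A" "0 \<le> B" "A + B \<le> 1" "0 \<le> X" "X \<le> 1 - h"
  shows "h + A * X - B * h \<in> {0..1}"
proof -
  have "B * h \<le> h"
    using assms by (intro mult_left_le_one_le) auto
  moreover have "A * X \<le> X"
    using assms by (intro mult_left_le_one_le) auto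
  moreover have "0 \<le> A * X" "0 \<le> B * h"
    using assms by auto
  ultimately show ?thesis
    using assms by (simp, linarith)
qed

section \<open>Maximum principle and discrete entropy inequality\<close>

theorem lemma3p4:
  fixes T \<eta> \<delta> dx dt lam L :: real
    and q_on q_off v \<omega> \<omega>\<^sub>d \<rho>\<^sub>0 :: "real \<Rightarrow> real"
    and N N\<^sub>T :: nat
    and k_on k_off ell :: int
    and \<Omega>_on \<Omega>_off :: "real set"
    and qn_on qn_off \<gamma> :: "nat \<Rightarrow> real"
    and \<gamma>h :: "int \<Rightarrow> real"
    and \<rho> \<rho>h R R_on S_on S_off :: "nat \<Rightarrow> int \<Rightarrow> real"
  assumes "T > 0"
    and "Linf {0..} {0..} q_on" and "Linf {0..} {0..} q_off"
    and "Ck_on 2 UNIV v" and "\<And>x. v x \<in> {0..1}" and "\<And>x. deriv v x \<le> 0"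
    and "\<eta> \<in> {0<..1}" and "\<delta> \<in> {-\<eta>..\<eta>}"
    and "Ck_on 1 {0..\<eta>} \<omega>" and "\<And>x. x \<in> {0..\<eta>} \<Longrightarrow> \<omega> x \<ge> 0"
    and "\<And>x. x \<in> {0..\<eta>} \<Longrightarrow> vector_derivative \<omega> (at x within {0..\<eta>}) \<le> 0"
    and "(LINT y:{0..\<eta>}|lebesgue. \<omega> y) = 1"
    and "Ck_on 1 {\<delta>-\<eta>..\<delta>+\<eta>} \<omega>\<^sub>d" and "\<And>x. x \<in> {\<delta>-\<eta>..\<delta>+\<eta>} \<Longrightarrow> \<omega>\<^sub>d x \<ge> 0"
    and "\<And>x. x \<in> {\<delta>-\<eta>..0} \<Longrightarrow> vector_derivative \<omega>\<^sub>d (at x within {\<delta>-\<eta>..\<delta>+\<eta>}) \<ge> 0"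
    and "\<And>x. x \<in> {0..\<delta>+\<eta>} \<Longrightarrow> vector_derivative \<omega>\<^sub>d (at x within {\<delta>-\<eta>..\<delta>+\<eta>}) \<le> 0"
    and "(LINT y:{\<delta>-\<eta>..\<delta>+\<eta>}|lebesgue. \<omega>\<^sub>d y) = 1"
    \<comment> \<open>mesh and ramps\<close>
    and "dx > 0" and "\<eta> = real N * dx" and "dt > 0" and "lam = dt / dx"
    and "real N\<^sub>T * dt \<le> T" and "T < (real N\<^sub>T + 1) * dt"
    and "ell > 0" and "L = real_of_int ell * dx"
    and "\<Omega>_on = {interface dx k_on..interface dx (k_on + ell)}"
    and "\<Omega>_off = {interface dx k_off..interface dx (k_off + ell)}"
    \<comment> \<open>discrete data\<close>
    and "L1_BV {0..1} \<rho>\<^sub>0"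
    and "\<And>j. \<rho> 0 j = 1 / dx * (LINT x:{interface dx (j - 1)..interface dx j}|lebesgue. \<rho>\<^sub>0 x)"
    and "\<And>n. n < N\<^sub>T \<Longrightarrow>
           qn_on n = 1 / dt * (LINT t:{real n * dt..real (Suc n) * dt}|lebesgue. q_on t)"
    and "\<And>n. n < N\<^sub>T \<Longrightarrow>
           qn_off n = 1 / dt * (LINT t:{real n * dt..real (Suc n) * dt}|lebesgue. q_off t)"
    and "\<And>p. p < N \<Longrightarrow> \<gamma> p = (LINT y:{real p * dx..real (Suc p) * dx}|lebesgue. \<omega> y)"
    and "\<And>h. \<gamma>h h = (LINT y:{of_int h * dx..of_int (h + 1) * dx}|lebesgue.
                       extend_zero {\<delta>-\<eta>..\<delta>+\<eta>} \<omega>\<^sub>d y)"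
    \<comment> \<open>scheme\<close>
    and "\<And>n j. n < N\<^sub>T \<Longrightarrow> R n j = (\<Sum>p<N. \<gamma> p * \<rho> n (j + int p + 1))"
    and "\<And>n j. n < N\<^sub>T \<Longrightarrow>
           \<rho>h n j = \<rho> n j - lam * (\<rho> n j * v (R n j) - \<rho> n (j - 1) * v (R n (j - 1)))"
    and "\<And>n j. n < N\<^sub>T \<Longrightarrow>
           R_on n j = (\<Sum>h = \<lfloor>(\<delta> - \<eta>) / dx\<rfloor>..\<lfloor>(\<delta> + \<eta>) / dx\<rfloor> - 1. \<gamma>h h * \<rho>h n (j + h))"
    and "\<And>n j. n < N\<^sub>T \<Longrightarrow> S_off n j = ramp_ind dx L \<Omega>_off j * qn_off n * \<rho>h n j"
    and "(\<forall>n<N\<^sub>T. \<forall>j. S_on n j = ramp_ind dx L \<Omega>_on j * qn_on n * (1 - \<rho>h n j) * (1 - R_on n j)) \<or>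
         (\<forall>n<N\<^sub>T. \<forall>j. S_on n j = ramp_ind dx L \<Omega>_on j * qn_on n * (1 - max (\<rho>h n j) (R_on n j)))"
    and "\<And>n j. n < N\<^sub>T \<Longrightarrow> \<rho> (Suc n) j = \<rho>h n j + dt * S_on n j - dt * S_off n j"
    \<comment> \<open>CFL condition; in ereal a vanishing denominator gives the bound \<infinity>\<close>
    and "ereal dt \<le> min
           (ereal dx / (ereal (\<gamma> 0) * Linf_norm {0..1} (deriv v) + Linf_norm {0..1} v))
           (ereal L / (Linf_norm {0..T} q_on + Linf_norm {0..T} q_off))"
  shows "\<forall>j. \<forall>n<N\<^sub>T. \<forall>\<kappa>\<in>{0..1}.
     \<bar>\<rho> (Suc n) j - \<kappa>\<bar> - \<bar>\<rho> n j - \<kappa>\<bar>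
     + lam * (K_flux v R \<kappa> n j (\<rho> n j) - K_flux v R \<kappa> n (j - 1) (\<rho> n (j - 1)))
     - dt * sgn (\<rho> (Suc n) j - \<kappa>) * (S_on n j - S_off n j)
     + lam * sgn (\<rho> (Suc n) j - \<kappa>) * \<kappa> * (v (R n j) - v (R n (j - 1))) \<le> 0"
proof -
  have T: "0 < T" and dx: "0 < dx" and dt: "0 < dt" and \<eta>: "\<eta> = real N * dx" and "0 < \<eta>"
    and ell: "0 < ell" and L: "L = real_of_int ell * dx"
    using assms(1,18,19,20,7,24,25) by simp_all
  have lam: "lam = dt / dx" "0 < lam"
    using assms(21) dx dt by simp_all
  have "0 < N"
    using \<eta> \<open>0 < \<eta>\<close> by (cases N) auto
  have "0 < L"
    using ell dx L by simp
  note rho0 = assms(28,29) and R = assms(34) and \<rho>h = assms(35) and R_on = assms(36)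
    and S_off = assms(37) and S_on = assms(38) and \<rho>_Suc = assms(39) and CFL = assms(40)

  have cont_\<omega>: "continuous_on {0..real N * dx} \<omega>"
    using Ck_on_1_imp_continuous_on[OF assms(9)] \<eta> by simp
  have anti_\<omega>: "antimono_on {0..real N * dx} \<omega>"
    using Ck_on_1_nonpos_imp_antimono_on[OF assms(9,11)] \<eta> by simp
  have "\<forall>x\<in>{0..real N * dx}. 0 \<le> \<omega> x" "(LINT y:{0..real N * dx}|lebesgue. \<omega> y) = 1"
    "\<forall>p<N. \<gamma> p = (LINT y:{real p * dx..real (Suc p) * dx}|lebesgue. \<omega> y)"
    using assms(10,12,32) unfolding \<eta> by blast+
  note \<gamma> = decreasing_kernel_cell_weights[OF cont_\<omega> anti_\<omega> this(1,2) dx this(3)]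
  have "\<forall>x\<in>{\<delta>-\<eta>..\<delta>+\<eta>}. 0 \<le> \<omega>\<^sub>d x"
    using assms(14) by blast
  note \<gamma>h = nonneg_kernel_cell_weights[OF Ck_on_1_imp_continuous_on[OF assms(13)] this assms(17) dx,
      folded assms(33)]

  note v = Ck_on_2_UNIV_deriv[OF assms(4)]
  obtain m' where m': "Linf_norm {0..1} (deriv v) = ereal m'"
      "\<And>x. x \<in> {0..1} \<Longrightarrow> \<bar>deriv v x\<bar> \<le> m'"
    by (rule Linf_norm_continuous_interval[OF zero_less_one continuous_on_subset[OF v(3) subset_UNIV]]) blast
  obtain m where m: "Linf_norm {0..1} v = ereal m" "\<And>x. x \<in> {0..1} \<Longrightarrow> \<bar>v x\<bar> \<le> m"
    by (rule Linf_norm_continuous_interval[OF zero_less_one continuous_on_subset[OF v(2) subset_UNIV]]) blast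
  have "0 \<le> m'" "0 \<le> m"
    using m'(2)[of 0] m(2)[of 0] by auto
  \<comment> \<open>\<open>D * (1 - \<rho> n j)\<close> will bound the loss of speed from the interface \<open>j - 1\<close> to the interface \<open>j\<close>.\<close>
  define D where "D = m' * \<gamma> 0"
  have "0 \<le> D"
    using \<open>0 \<le> m'\<close> \<gamma>(1)[OF \<open>0 < N\<close>] by (simp add: D_def)

  obtain Q_on where Q_on: "Linf_norm {0..T} q_on = ereal Q_on" "0 \<le> Q_on"
      "\<And>s t. 0 \<le> s \<Longrightarrow> s < t \<Longrightarrow> t \<le> T \<Longrightarrow> (LINT x:{s..t}|lebesgue. q_on x) \<in> {0..(t - s) * Q_on}"
    by (rule Linf_nonneg_integral_bounds[OF assms(2) T]) blast
  obtain Q_off where Q_off: "Linf_norm {0..T} q_off = ereal Q_off" "0 \<le> Q_off"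
      "\<And>s t. 0 \<le> s \<Longrightarrow> s < t \<Longrightarrow> t \<le> T \<Longrightarrow> (LINT x:{s..t}|lebesgue. q_off x) \<in> {0..(t - s) * Q_off}"
    by (rule Linf_nonneg_integral_bounds[OF assms(3) T]) blast
  have step: "real n * dt < real (Suc n) * dt" "real (Suc n) * dt \<le> T"
    "real (Suc n) * dt - real n * dt = dt" "0 \<le> real n * dt" if "n < N\<^sub>T" for n
  proof -
    have "real (Suc n) * dt \<le> real N\<^sub>T * dt"
      using that dt by (intro mult_right_mono) auto
    with \<open>real N\<^sub>T * dt \<le> T\<close> show "real (Suc n) * dt \<le> T"
      by linarith
  qed (use dt in \<open>auto simp: algebra_simps\<close>)
  have qn_on: "qn_on n \<in> {0..Q_on}" if "n < N\<^sub>T" for n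
    using Q_on(3)[OF step(4,1,2)[OF that]] dt unfolding assms(30)[OF that] step(3)[OF that]
    by (simp add: field_simps)
  have qn_off: "qn_off n \<in> {0..Q_off}" if "n < N\<^sub>T" for n
    using Q_off(3)[OF step(4,1,2)[OF that]] dt unfolding assms(31)[OF that] step(3)[OF that]
    by (simp add: field_simps)

  have "dt * (\<gamma> 0 * m' + m) \<le> dx"
    using CFL dx \<open>0 \<le> m'\<close> \<open>0 \<le> m\<close> \<gamma>(1)[OF \<open>0 < N\<close>]
    by (intro ereal_le_divide_imp_mult_le) (auto simp: m'(1) m(1))
  then have cfl: "lam * (D + m) \<le> 1"
    using dx by (simp add: lam(1) D_def field_simps)
  have cfl_source: "dt * (Q_on + Q_off) \<le> L"
    using CFL \<open>0 < L\<close> Q_on(2) Q_off(2)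
    by (intro ereal_le_divide_imp_mult_le) (auto simp: Q_on(1) Q_off(1))

  have R_unit: "R n j \<in> {0..1}" if "n < N\<^sub>T" and "\<And>j. \<rho> n j \<in> {0..1}" for n j
    unfolding R[OF that(1)] using \<gamma>(1,3) that(2) by (intro weighted_sum_in_unit_interval) auto
  have lam_v: "lam * v (R n j) \<le> 1" if "n < N\<^sub>T" and "\<And>j. \<rho> n j \<in> {0..1}" for n j
  proof -
    have "lam * v (R n j) \<le> lam * (D + m)"
      using m(2)[OF R_unit[OF that], of j] \<open>0 \<le> D\<close> lam(2) by (intro mult_left_mono) auto
    with cfl show ?thesis
      by linarith
  qed

  have \<rho>h_unit: "\<rho>h n j \<in> {0..1}" if n: "n < N\<^sub>T" and \<rho>: "\<And>j. \<rho> n j \<in> {0..1}" for n j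
    unfolding \<rho>h[OF n]
  proof (rule upwind_step_in_unit_interval[where B = m and D = D])
    have "R n j - R n (j - 1) \<le> \<gamma> 0 * (1 - \<rho> n j)"
      using downstream_average_increment[of N \<gamma> "\<rho> n" j, OF \<open>0 < N\<close> \<gamma>(1,2)] \<rho>
      by (simp add: R[OF n] algebra_simps)
    moreover have "0 \<le> \<gamma> 0 * (1 - \<rho> n j)"
      using \<gamma>(1)[OF \<open>0 < N\<close>] \<rho>[of j] by simp
    ultimately have "v (R n (j - 1)) - v (R n j) \<le> m' * (\<gamma> 0 * (1 - \<rho> n j))"
      using assms(6) m'(2) R_unit[OF n \<rho>]
      by (intro nonincreasing_drop_le[OF v(1)]) auto
    then show "v (R n (j - 1)) - v (R n j) \<le> D * (1 - \<rho> n j)"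
      by (simp add: D_def mult.assoc)
    show "v (R n j) \<le> m"
      using m(2)[OF R_unit[OF n \<rho>, of j]] by simp
  qed (use \<rho> assms(5) lam(2) \<open>0 \<le> D\<close> cfl in auto)

  have \<rho>_Suc_unit: "\<rho> (Suc n) j \<in> {0..1}" if n: "n < N\<^sub>T" and \<rho>: "\<And>j. \<rho> n j \<in> {0..1}" for n j
  proof -
    define A where "A = dt * (ramp_ind dx L \<Omega>_on j * qn_on n)"
    define B where "B = dt * (ramp_ind dx L \<Omega>_off j * qn_off n)"
    have ramp: "ramp_ind dx L \<Omega> j \<in> {0..1 / L}" for \<Omega>
      using \<open>0 < L\<close> by (simp add: ramp_ind_def)
    have A: "0 \<le> A" "A \<le> dt * (1 / L * Q_on)" and B: "0 \<le> B" "B \<le> dt * (1 / L * Q_off)"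
      unfolding A_def B_def using ramp qn_on[OF n] qn_off[OF n] dt \<open>0 < L\<close>
      by (auto intro!: mult_left_mono mult_mono mult_nonneg_nonneg simp del: times_divide_eq_left)
    have "A + B \<le> dt * (Q_on + Q_off) / L"
      using A B by (simp add: algebra_simps add_divide_distrib)
    also have "\<dots> \<le> 1"
      using cfl_source \<open>0 < L\<close> by simp
    finally have AB: "A + B \<le> 1" .
    note h = \<rho>h_unit[OF n \<rho>]
    have R_on_unit: "R_on n j \<in> {0..1}"
      unfolding R_on[OF n] using h by (intro weighted_sum_in_unit_interval \<gamma>h) auto
    \<comment> \<open>\<open>X\<close> is the inflow factor of whichever of the two models is in force.\<close>
    obtain X where X: "0 \<le> X" "X \<le> 1 - \<rho>h n j" "dt * S_on n j = A * X"
    proof (cases "S_on n j = ramp_ind dx L \<Omega>_on j * qn_on n * (1 - \<rho>h n j) * (1 - R_on n j)")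
      case True
      have "(1 - \<rho>h n j) * (1 - R_on n j) \<le> 1 - \<rho>h n j"
        using h[of j] R_on_unit by (intro mult_right_le_one_le) auto
      with True h[of j] R_on_unit show ?thesis
        by (intro that[of "(1 - \<rho>h n j) * (1 - R_on n j)"]) (auto simp: A_def)
    next
      case False
      with S_on n have "S_on n j = ramp_ind dx L \<Omega>_on j * qn_on n * (1 - max (\<rho>h n j) (R_on n j))"
        by auto
      with h[of j] R_on_unit show ?thesis
        by (intro that[of "1 - max (\<rho>h n j) (R_on n j)"]) (auto simp: A_def)
    qed
    have "\<rho> (Suc n) j = \<rho>h n j + A * X - B * \<rho>h n j"
      unfolding \<rho>_Suc[OF n] X(3) S_off[OF n] by (simp add: B_def)
    with source_step_in_unit_interval[OF h A(1) B(1) AB X(1,2)] show ?thesis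
      by simp
  qed

  have \<rho>_unit: "\<rho> n j \<in> {0..1}" if "n \<le> N\<^sub>T" for n j
    using that
  proof (induction n arbitrary: j)
    case 0
    let ?J = "{interface dx (j - 1)..interface dx j}"
    have len: "interface dx j - interface dx (j - 1) = dx"
      by (simp add: interface_def algebra_simps)
    have "\<rho>\<^sub>0 \<in> borel_measurable (lebesgue_on ?J)"
      using rho0(1) by (intro measurable_restrict_space1) (auto simp: L1_BV_def)
    moreover have "AE x in lebesgue. x \<in> ?J \<longrightarrow> \<rho>\<^sub>0 x \<in> {0..1}"
      using rho0(1) unfolding L1_BV_def by (auto intro: eventually_mono)
    ultimately have "(LINT x:?J|lebesgue. \<rho>\<^sub>0 x) \<in> {dx * 0..dx * 1}"
      using set_integral_Icc_bounds[of "interface dx (j - 1)" "interface dx j" \<rho>\<^sub>0 0 1] dx len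
      by auto
    then show ?case
      unfolding rho0(2) using dx by (simp add: field_simps)
  next
    case (Suc n)
    then show ?case
      by (intro \<rho>_Suc_unit) auto
  qed

  show ?thesis
  proof (intro allI impI ballI)
    fix j n \<kappa> assume n: "n < N\<^sub>T" and "\<kappa> \<in> {0..1::real}"
    define V where "V = v (R n j)"
    define W where "W = v (R n (j - 1))"
    define s where "s = sgn (\<rho> (Suc n) j - \<kappa>)"
    \<comment> \<open>\<open>e\<close> compares the upwind step with the same step applied to the constant state \<open>\<kappa>\<close>, which is moved
      because the speeds differ; this is the origin of the last term of the claim.\<close>
    define e where "e = \<rho>h n j - (\<kappa> - lam * \<kappa> * (V - W))"
    have "lam * V \<le> 1"
      unfolding V_def using n \<rho>_unit by (intro lam_v) auto
    moreover have "0 \<le> lam * W"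
      using lam(2) assms(5) by (simp add: W_def)
    ultimately have "\<bar>e\<bar> \<le> \<bar>\<rho> n j - \<kappa>\<bar>
        - lam * (K_flux v R \<kappa> n j (\<rho> n j) - K_flux v R \<kappa> n (j - 1) (\<rho> n (j - 1)))"
      using upwind_entropy_inequality[of lam V W "\<rho> n j" "\<rho> n (j - 1)" \<kappa>]
      unfolding e_def \<rho>h[OF n] K_flux_def G_flux_def V_def W_def by blast
    moreover have "s * e \<le> \<bar>e\<bar>"
      by (auto simp: s_def sgn_if)
    moreover have "s * e = \<bar>\<rho> (Suc n) j - \<kappa>\<bar> - dt * s * (S_on n j - S_off n j) + lam * s * \<kappa> * (V - W)"
    proof -
      have e: "e = (\<rho> (Suc n) j - \<kappa>) - dt * (S_on n j - S_off n j) + lam * \<kappa> * (V - W)"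
        unfolding e_def \<rho>_Suc[OF n] by (simp add: algebra_simps)
      have "s * e = s * (\<rho> (Suc n) j - \<kappa>) - dt * s * (S_on n j - S_off n j)
          + lam * s * \<kappa> * (V - W)"
        unfolding e by (simp add: algebra_simps)
      also have "s * (\<rho> (Suc n) j - \<kappa>) = \<bar>\<rho> (Suc n) j - \<kappa>\<bar>"
        by (simp add: s_def mult.commute abs_sgn)
      finally show ?thesis .
    qed
    ultimately show "\<bar>\<rho> (Suc n) j - \<kappa>\<bar> - \<bar>\<rho> n j - \<kappa>\<bar>
     + lam * (K_flux v R \<kappa> n j (\<rho> n j) - K_flux v R \<kappa> n (j - 1) (\<rho> n (j - 1)))
     - dt * sgn (\<rho> (Suc n) j - \<kappa>) * (S_on n j - S_off n j)
     + lam * sgn (\<rho> (Suc n) j - \<kappa>) * \<kappa> * (v (R n j) - v (R n (j - 1))) \<le> 0"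
      unfolding V_def W_def s_def by linarith
  qed
qed

end
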